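(* Let $f:\mathbb{R}^n\to\mathbb{R}$ and $g:\mathbb{R}^m\to\mathbb{R}$ satisfy $f\in\mathcal{S}(0,\beta_f)$ and $g\in\mathcal{S}(\mu_g,\beta_g)$ with $0<\mu_g\le\beta_g$, and let $A\in\mathbb{R}^{m\times n}$ have full column rank, with maximum and minimum singular values $\sigma_{\max}$ and $\sigma_{\min}$. Put $$\mu_p=\frac{\sigma_{\min}^2}{\beta_g},\quad \beta_p=\frac{\sigma_{\max}^2}{\mu_g}+\beta_f,\quad \beta_\phi=\frac{\sigma_{\max}}{\mu_g},\quad \alpha_p=\frac{\mu_p\beta_p}{\mu_p+\beta_p},\quad \alpha_g=\frac{\mu_g\beta_g}{\mu_g+\beta_g}.$$ Let $\eta_2\in(0,2/(\mu_g+\beta_g)]$ and, from arbitrary initial points $x^0\in\mathbb{R}^n$, $y^0\in\mathbb{R}^m$, let $\{x^k\}$ and $\{y^k\}$ be generated for $k\ge 0$ by $$x^{k+1}=x^k-\eta_1\left(\nabla f(x^k)+A^Ty^k\right),\qquad y^{k+1}=y^k+\eta_2\left(Ax^k-\nabla g(y^k)\right).$$ Then, for any $\eta_1$ satisfying $$0<\eta_1<\min\left\{\frac{\alpha_p\alpha_g\eta_2}{\sigma_{\max}\beta_\phi(\alpha_p+\beta_p)},\ \frac{2}{\mu_p+\beta_p}\right\},$$ the sequences $\{x^k\}$ and $\{y^k\}$ converge exponentially to the primal and dual optimal solutions $x^\star$ and $y^\star$, respectively.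
   Context: For $\mu\ge 0$ and $\beta>0$, $\mathcal{S}(\mu,\beta)$ denotes the set of real-valued differentiable functions on a Euclidean space that are $\mu$-strongly convex and $\beta$-smooth (i.e. with $\beta$-Lipschitz gradient); $\mathcal{S}(0,\beta)$ denotes the set of convex $\beta$-smooth functions. Norms are Euclidean. The minimax problem is $\min_{x\in\mathbb{R}^n}\max_{y\in\mathbb{R}^m}L(x,y)$ with $L(x,y)=f(x)+y^TAx-g(y)$. The primal problem is to minimize $p(x)=\max_y L(x,y)$ over $x\in\mathbb{R}^n$; the dual problem is to maximize $d(y)=\min_x L(x,y)$ over $y\in\mathbb{R}^m$ (with $\min$ understood as infimum). Under the stated assumptions the primal and dual optimal solutions are unique; they are denoted $x^\star$ and $y^\star$. A sequence $\{z^k\}$ converges exponentially to $z^\star$ if there are $C\ge 0$ and $r\in[0,1)$ with $\|z^k-z^\star\|\le Cr^k$ for all $k\ge 0$. *)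

theory Defs
  imports "HOL-Analysis.Analysis"
begin

text \<open>Meaningful only where the function is differentiable.\<close>

definition grad :: "('a::euclidean_space \<Rightarrow> real) \<Rightarrow> 'a \<Rightarrow> 'a" where
  "grad f x = (THE D. GDERIV f x :> D)"

definition strongly_convex :: "real \<Rightarrow> ('a::euclidean_space \<Rightarrow> real) \<Rightarrow> bool" where
  "strongly_convex \<mu> f \<longleftrightarrow>
     (\<forall>x y. \<forall>t\<in>{0..1}. f ((1 - t) *\<^sub>R x + t *\<^sub>R y)
        \<le> (1 - t) * f x + t * f y - \<mu> / 2 * t * (1 - t) * (norm (x - y))\<^sup>2)"

text \<open>For \<open>\<mu> = 0\<close> the strong convexity inequality is ordinary convexity.\<close>

definition smooth_convex_class :: "real \<Rightarrow> real \<Rightarrow> ('a::euclidean_space \<Rightarrow> real) set" where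
  "smooth_convex_class \<mu> \<beta> =
     {f. (\<forall>x. f differentiable (at x)) \<and> strongly_convex \<mu> f \<and> \<beta>-lipschitz_on UNIV (grad f)}"

text \<open>
  An \<open>m\<close> by \<open>n\<close> matrix receives the square roots of the \<open>n\<close> eigenvalues of the Gram matrix, which
  agrees with the usual list of \<open>min m n\<close> singular values when \<open>n \<le> m\<close>, in particular for
  full column rank. For \<open>n > m\<close> the set always contains \<open>0\<close>.
\<close>

definition singular_values :: "real^'n^'m \<Rightarrow> real set" where
  "singular_values A =
     {sqrt l | l. \<exists>v. v \<noteq> 0 \<and> (transpose A ** A) *v v = l *\<^sub>R v}"

definition sigma_max :: "real^'n^'m \<Rightarrow> real" where
  "sigma_max A = Max (singular_values A)"

definition sigma_min :: "real^'n^'m \<Rightarrow> real" where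
  "sigma_min A = Min (singular_values A)"

definition saddle_fun ::
  "(real^'n \<Rightarrow> real) \<Rightarrow> (real^'m \<Rightarrow> real) \<Rightarrow> real^'n^'m \<Rightarrow> real^'n \<Rightarrow> real^'m \<Rightarrow> real" where
  "saddle_fun f g A x y = f x + y \<bullet> (A *v x) - g y"

text \<open>
  Extended reals are needed because the dual function may take the value \<open>-\<infinity>\<close>; an infimum in
  the type of reals would then be a meaningless number.
\<close>

definition primal_fun ::
  "(real^'n \<Rightarrow> real) \<Rightarrow> (real^'m \<Rightarrow> real) \<Rightarrow> real^'n^'m \<Rightarrow> real^'n \<Rightarrow> ereal" where
  "primal_fun f g A x = (SUP y. ereal (saddle_fun f g A x y))"

definition dual_fun ::
  "(real^'n \<Rightarrow> real) \<Rightarrow> (real^'m \<Rightarrow> real) \<Rightarrow> real^'n^'m \<Rightarrow> real^'m \<Rightarrow> ereal" where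
  "dual_fun f g A y = (INF x. ereal (saddle_fun f g A x y))"

definition primal_optimal ::
  "(real^'n \<Rightarrow> real) \<Rightarrow> (real^'m \<Rightarrow> real) \<Rightarrow> real^'n^'m \<Rightarrow> real^'n \<Rightarrow> bool" where
  "primal_optimal f g A xs \<longleftrightarrow> (\<forall>x. primal_fun f g A xs \<le> primal_fun f g A x)"

definition dual_optimal ::
  "(real^'n \<Rightarrow> real) \<Rightarrow> (real^'m \<Rightarrow> real) \<Rightarrow> real^'n^'m \<Rightarrow> real^'m \<Rightarrow> bool" where
  "dual_optimal f g A ys \<longleftrightarrow> (\<forall>y. dual_fun f g A y \<le> dual_fun f g A ys)"

definition converges_exponentially :: "(nat \<Rightarrow> 'a::real_normed_vector) \<Rightarrow> 'a \<Rightarrow> bool" where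
  "converges_exponentially z zs \<longleftrightarrow>
     (\<exists>C r. 0 \<le> C \<and> 0 \<le> r \<and> r < 1 \<and> (\<forall>k. norm (z k - zs) \<le> C * r ^ k))"

end

theory Submission
  imports Defs
begin

text \<open>
  Since \<open>\<nabla>g\<close> is a bijection, the maximizer of \<open>L(x, \<cdot>)\<close> is \<open>\<phi>(x) = (\<nabla>g)\<^sup>-\<^sup>1(A x)\<close>, and the primal function
  \<open>p(x) = f(x) + g\<^sup>*(A x)\<close> has gradient \<open>\<nabla>f(x) + A\<^sup>T \<phi>(x)\<close>, is \<open>\<mu>\<^sub>p\<close>-strongly convex and \<open>\<beta>\<^sub>p\<close>-smooth.
  The primal step is therefore an inexact gradient step on \<open>p\<close>, and the dual step is a gradient step
  towards \<open>\<phi>(x\<^sup>k)\<close>. The errors \<open>\<parallel>x\<^sup>k - x\<^sup>\<star>\<parallel>\<close> and \<open>\<parallel>y\<^sup>k - \<phi>(x\<^sup>k)\<parallel>\<close> obey a coupled linear recursion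
  with a nonnegative \<open>2 \<times> 2\<close> matrix \<open>M\<close>, and the bound on \<open>\<eta>\<^sub>1\<close> says exactly that \<open>det (I - M) > 0\<close>.
\<close>

section \<open>Functions with strongly monotone and Lipschitz gradients\<close>

lemma gderiv_along_line:
  assumes "\<And>x. GDERIV q x :> G x"
  shows "((\<lambda>t. q (x + t *\<^sub>R d)) has_real_derivative d \<bullet> G (x + t *\<^sub>R d)) (at t)"
proof -
  have 1: "((\<lambda>t. x + t *\<^sub>R d) has_derivative (\<lambda>h. h *\<^sub>R d)) (at t)"
    by (auto intro!: derivative_eq_intros)
  have 2: "(q has_derivative (\<lambda>h. h \<bullet> G (x + t *\<^sub>R d))) (at (x + t *\<^sub>R d))"
    using assms by (simp add: gderiv_def)
  show ?thesis
    using has_derivative_compose[OF 1 2]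
    by (simp add: has_field_derivative_def mult.commute[of "d \<bullet> _"] mult_commute_abs)
qed

text \<open>Serves to differentiate the conjugate, whose linearization error is bounded
  quadratically.\<close>

lemma gderiv_if_quadratic_error:
  assumes "\<And>y. \<bar>q y - q x - (y - x) \<bullet> D\<bar> \<le> C * (norm (y - x))\<^sup>2"
  shows "GDERIV q x :> D"
  unfolding gderiv_def has_derivative_at_alt
proof (intro conjI allI impI)
  show "bounded_linear (\<lambda>h. h \<bullet> D)"
    by (rule bounded_linear_inner_left)
  fix e :: real
  assume e: "e > 0"
  show "\<exists>d>0. \<forall>y. norm (y - x) < d \<longrightarrow> norm (q y - q x - (y - x) \<bullet> D) \<le> e * norm (y - x)"
  proof (intro exI conjI allI impI)
    show "e / (\<bar>C\<bar> + 1) > 0" using e by (simp add: add_nonneg_pos)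
    fix y assume y: "norm (y - x) < e / (\<bar>C\<bar> + 1)"
    have "C * norm (y - x) \<le> (\<bar>C\<bar> + 1) * norm (y - x)"
      by (intro mult_right_mono) auto
    also have "\<dots> \<le> e"
      using y by (simp add: field_simps add_nonneg_pos)
    finally have "C * norm (y - x) * norm (y - x) \<le> e * norm (y - x)"
      by (intro mult_right_mono) auto
    then show "norm (q y - q x - (y - x) \<bullet> D) \<le> e * norm (y - x)"
      using assms[of y] by (simp add: power2_eq_square mult.assoc)
  qed
qed

text \<open>\<open>grad\<close> is a definite description, so uniqueness is needed besides
  existence. The Riesz representative of the derivative \<open>L\<close> is
  \<open>adjoint L 1\<close>.\<close>

lemma gderiv_grad:
  assumes "f differentiable (at x)"
  shows "GDERIV f x :> grad f x"
proof -
  obtain L where L: "(f has_derivative L) (at x)"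
    using assms by (auto simp: differentiable_def)
  then have lin: "linear L" by (rule has_derivative_linear)
  have "L = (\<lambda>h. h \<bullet> adjoint L 1)"
    using adjoint_works[OF lin] by auto
  with L have D: "GDERIV f x :> adjoint L 1" by (simp add: gderiv_def)
  have "D' = adjoint L 1" if "GDERIV f x :> D'" for D'
  proof -
    have "(\<lambda>h. h \<bullet> D') = (\<lambda>h. h \<bullet> adjoint L 1)"
      using that D unfolding gderiv_def by (rule has_derivative_unique)
    then show ?thesis by (metis vector_eq_ldot)
  qed
  with D show ?thesis unfolding grad_def by (metis (mono_tags, lifting) theI)
qed

text \<open>Strong convexity and smoothness as two-sided bounds on an inner product, a form that
  passes to sums, to composition with a matrix and, for \<open>\<mu> > 0\<close>, to conjugates. The
  gradient is a parameter, so that \<open>inv G\<close> can take its place.\<close>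

locale smooth_gradient =
  fixes q :: "'a::euclidean_space \<Rightarrow> real" and G :: "'a \<Rightarrow> 'a" and \<mu> \<beta> :: real
  assumes gderiv: "\<And>x. GDERIV q x :> G x"
    and strongly_monotone: "\<And>x y. \<mu> * (norm (x - y))\<^sup>2 \<le> (x - y) \<bullet> (G x - G y)"
    and upper_lipschitz: "\<And>x y. (x - y) \<bullet> (G x - G y) \<le> \<beta> * (norm (x - y))\<^sup>2"
    and modulus_le: "\<mu> \<le> \<beta>"
    and modulus_nonneg: "0 \<le> \<mu>"
    and constant_pos: "0 < \<beta>"
begin

text \<open>Subtracting the quadratic terms from \<open>q\<close> along the segment leaves a
  function \<open>r\<close> whose derivative is nonnegative by strong monotonicity.\<close>

lemma quadratic_lower_bound: "q x + (y - x) \<bullet> G x + \<mu> / 2 * (norm (y - x))\<^sup>2 \<le> q y"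
proof -
  define d where "d = y - x"
  define r where "r t = q (x + t *\<^sub>R d) - t * (d \<bullet> G x) - \<mu> / 2 * t\<^sup>2 * (norm d)\<^sup>2" for t
  have "r 0 \<le> r 1"
  proof (rule DERIV_nonneg_imp_nondecreasing[of 0 1 r])
    fix t :: real assume t: "0 \<le> t"
    have "(r has_real_derivative d \<bullet> G (x + t *\<^sub>R d) - d \<bullet> G x - \<mu> * t * (norm d)\<^sup>2) (at t)"
      unfolding r_def
      by (rule derivative_eq_intros gderiv_along_line gderiv | simp)+
    moreover have "d \<bullet> G (x + t *\<^sub>R d) - d \<bullet> G x - \<mu> * t * (norm d)\<^sup>2 \<ge> 0"
    proof (cases "t = 0")
      case False
      \<comment> \<open>Monotonicity between \<open>x + t *\<^sub>R d\<close> and \<open>x\<close>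
        yields the inequality multiplied by \<open>t\<close>, which is why \<open>t = 0\<close> is
        split off.\<close>
      have "t * (\<mu> * t * (norm d)\<^sup>2) \<le> t * (d \<bullet> G (x + t *\<^sub>R d) - d \<bullet> G x)"
        using strongly_monotone[of "x + t *\<^sub>R d" x]
        by (simp add: inner_diff_right power_mult_distrib power2_eq_square algebra_simps)
      with False t show ?thesis by (simp add: mult_le_cancel_left)
    qed simp
    ultimately show "\<exists>y. (r has_real_derivative y) (at t) \<and> 0 \<le> y" by blast
  qed simp
  then show ?thesis by (simp add: r_def d_def)
qed

lemma quadratic_upper_bound: "q y \<le> q x + (y - x) \<bullet> G x + \<beta> / 2 * (norm (y - x))\<^sup>2"
proof -
  define d where "d = y - x"
  define r where "r t = t * (d \<bullet> G x) + \<beta> / 2 * t\<^sup>2 * (norm d)\<^sup>2 - q (x + t *\<^sub>R d)" for t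
  have "r 0 \<le> r 1"
  proof (rule DERIV_nonneg_imp_nondecreasing[of 0 1 r])
    fix t :: real assume t: "0 \<le> t"
    have "(r has_real_derivative d \<bullet> G x + \<beta> * t * (norm d)\<^sup>2 - d \<bullet> G (x + t *\<^sub>R d)) (at t)"
      unfolding r_def
      by (rule derivative_eq_intros gderiv_along_line gderiv | simp)+
    moreover have "d \<bullet> G x + \<beta> * t * (norm d)\<^sup>2 - d \<bullet> G (x + t *\<^sub>R d) \<ge> 0"
    proof (cases "t = 0")
      case False
      have "t * (d \<bullet> G (x + t *\<^sub>R d) - d \<bullet> G x) \<le> t * (\<beta> * t * (norm d)\<^sup>2)"
        using upper_lipschitz[of "x + t *\<^sub>R d" x]
        by (simp add: inner_diff_right power_mult_distrib power2_eq_square algebra_simps)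
      with False t show ?thesis by (simp add: mult_le_cancel_left)
    qed simp
    ultimately show "\<exists>y. (r has_real_derivative y) (at t) \<and> 0 \<le> y" by blast
  qed simp
  then show ?thesis by (simp add: r_def d_def)
qed

lemma minimizer_if_zero:
  assumes "G x = 0"
  shows "q x + \<mu> / 2 * (norm (y - x))\<^sup>2 \<le> q y"
  using quadratic_lower_bound[of x y] assms by simp

text \<open>
  The Baillon--Haddad argument: compare the lower model at \<open>y\<close> with the upper model at \<open>x\<close> in the
  point \<open>x - s w\<close>, for a free \<open>s\<close> so that the degenerate case \<open>\<mu> = \<beta>\<close> is covered.
\<close>

lemma cocoercive_shifted:
  defines "w x y \<equiv> G x - G y - \<mu> *\<^sub>R (x - y)"
  shows "(2 * s - (\<beta> - \<mu>) * s\<^sup>2) * (norm (w x y))\<^sup>2 \<le> (x - y) \<bullet> w x y"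
proof -
  have half: "q y - q x + (x - y) \<bullet> G y + \<mu> / 2 * (norm (x - y))\<^sup>2 + s * (norm (w x y))\<^sup>2
      \<le> (\<beta> - \<mu>) / 2 * s\<^sup>2 * (norm (w x y))\<^sup>2" for x y
  proof -
    define z where "z = x - s *\<^sub>R w x y"
    define d where "d = x - y"
    have zy: "z - y = d - s *\<^sub>R w x y" and zx: "z - x = - (s *\<^sub>R w x y)"
      by (simp_all add: z_def d_def)
    have Gx: "G x = G y + \<mu> *\<^sub>R d + w x y" by (simp add: w_def d_def)
    have "q y + (z - y) \<bullet> G y + \<mu> / 2 * (norm (z - y))\<^sup>2
        \<le> q x + (z - x) \<bullet> G x + \<beta> / 2 * (norm (z - x))\<^sup>2"
      using quadratic_lower_bound[of y z] quadratic_upper_bound[of z x] by linarith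
    then show ?thesis
      unfolding zx zy d_def[symmetric] Gx power2_norm_eq_inner
      by (simp add: inner_diff_left inner_diff_right inner_add_right
          inner_commute power2_eq_square field_simps)
  qed
  \<comment> \<open>Adding the two instances of \<open>half\<close> cancels the values of
    \<open>q\<close>.\<close>
  have w_swap: "w y x = - w x y" by (simp add: w_def algebra_simps)
  have "(x - y) \<bullet> w x y = (x - y) \<bullet> G x - (x - y) \<bullet> G y - \<mu> * (norm (x - y))\<^sup>2"
    by (simp add: w_def inner_diff_right power2_norm_eq_inner)
  moreover have "(y - x) \<bullet> G x = - ((x - y) \<bullet> G x)"
    by (simp add: inner_diff_left)
  ultimately show ?thesis
    using half[of x y] half[of y x]
    by (simp add: w_swap norm_minus_commute[of y x] algebra_simps)
qed

text \<open>In terms of \<open>w\<close> and \<open>d\<close> below, the claim is equivalent to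
  \<open>(norm w)\<^sup>2 \<le> (\<beta> - \<mu>) * (d \<bullet> w)\<close>.\<close>

lemma cocoercive:
  "\<mu> * \<beta> * (norm (x - y))\<^sup>2 + (norm (G x - G y))\<^sup>2 \<le> (\<mu> + \<beta>) * ((x - y) \<bullet> (G x - G y))"
proof -
  define w where "w = G x - G y - \<mu> *\<^sub>R (x - y)"
  define d where "d = x - y"
  have *: "(2 * s - (\<beta> - \<mu>) * s\<^sup>2) * (norm w)\<^sup>2 \<le> d \<bullet> w" for s
    using cocoercive_shifted[of s x y] by (simp add: w_def d_def)
  have Gxy: "G x - G y = \<mu> *\<^sub>R d + w" by (simp add: w_def d_def)
  have "(norm w)\<^sup>2 \<le> (\<beta> - \<mu>) * (d \<bullet> w)"
  proof (cases "\<beta> = \<mu>")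
    case True
    \<comment> \<open>If the moduli agree, the upper bound gives this sign, and \<open>s = 1\<close>
      then forces \<open>w = 0\<close>.\<close>
    have "d \<bullet> w \<le> 0"
      using upper_lipschitz[of x y] True
      by (simp add: Gxy d_def[symmetric] inner_add_right power2_norm_eq_inner)
    moreover have "2 * (norm w)\<^sup>2 \<le> d \<bullet> w" using *[of 1] True by simp
    ultimately have "(norm w)\<^sup>2 \<le> 0" by linarith
    then show ?thesis using True by simp
  next
    case False
    with modulus_le have L: "\<beta> - \<mu> > 0" by simp
    \<comment> \<open>\<open>s = 1 / (\<beta> - \<mu>)\<close> maximizes
      \<open>2 * s - (\<beta> - \<mu>) * s\<^sup>2\<close>.\<close>
    have "(norm w)\<^sup>2 / (\<beta> - \<mu>) \<le> d \<bullet> w"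
      using *[of "1 / (\<beta> - \<mu>)"] L by (simp add: power2_eq_square)
    with L show ?thesis by (simp add: divide_le_eq mult.commute)
  qed
  then show ?thesis
    unfolding Gxy d_def[symmetric]
    by (simp add: power2_norm_eq_inner inner_add_left inner_add_right
        inner_commute algebra_simps)
qed

text \<open>In the expanded square, cocoercivity absorbs the term in \<open>(norm D)\<^sup>2\<close>
  because of the upper bound on \<open>\<eta>\<close>. This leaves the factor
  \<open>1 - 2 * (\<eta> * \<alpha>)\<close>, which is at most
  \<open>(1 - \<eta> * \<alpha>)\<^sup>2\<close>.\<close>

lemma gradient_step_contraction:
  assumes "0 \<le> \<eta>" and "\<eta> \<le> 2 / (\<mu> + \<beta>)"
  shows "norm ((x - \<eta> *\<^sub>R G x) - (y - \<eta> *\<^sub>R G y)) \<le> (1 - \<eta> * (\<mu> * \<beta> / (\<mu> + \<beta>))) * norm (x - y)"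
proof -
  define d where "d = x - y"
  define D where "D = G x - G y"
  define \<alpha> where "\<alpha> = \<mu> * \<beta> / (\<mu> + \<beta>)"
  have sum_pos: "\<mu> + \<beta> > 0" using modulus_nonneg constant_pos by simp
  \<comment> \<open>The contraction factor must be nonnegative for the passage from squares to
    norms.\<close>
  have "\<eta> * \<alpha> \<le> 2 / (\<mu> + \<beta>) * \<alpha>"
    using assms modulus_nonneg constant_pos by (intro mult_right_mono) (auto simp: \<alpha>_def)
  also have "\<dots> = 2 * \<mu> * \<beta> / (\<mu> + \<beta>)\<^sup>2" by (simp add: \<alpha>_def power2_eq_square)
  also have "\<dots> \<le> 1"
  proof (rule divide_le_eq_1_pos[THEN iffD2])
    show "0 < (\<mu> + \<beta>)\<^sup>2" using sum_pos by simp
    show "2 * \<mu> * \<beta> \<le> (\<mu> + \<beta>)\<^sup>2" by (simp add: power2_sum)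
  qed
  finally have le1: "\<eta> * \<alpha> \<le> 1" .
  define E where "E = (norm D)\<^sup>2 / (\<mu> + \<beta>)"
  have "\<alpha> * (norm d)\<^sup>2 + E \<le> d \<bullet> D"
    using cocoercive[of x y] sum_pos
    by (simp add: \<alpha>_def d_def D_def E_def add_divide_distrib[symmetric] pos_divide_le_eq mult.commute)
  then have 1: "\<eta> * (\<alpha> * (norm d)\<^sup>2 + E) \<le> \<eta> * (d \<bullet> D)"
    using assms(1) by (rule mult_left_mono)
  have "\<eta> * \<eta> \<le> \<eta> * (2 / (\<mu> + \<beta>))"
    using assms by (intro mult_left_mono)
  then have "\<eta>\<^sup>2 * (norm D)\<^sup>2 \<le> \<eta> * (2 / (\<mu> + \<beta>)) * (norm D)\<^sup>2"
    unfolding power2_eq_square[of \<eta>] by (rule mult_right_mono) simp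
  then have 2: "\<eta>\<^sup>2 * (norm D)\<^sup>2 \<le> 2 * (\<eta> * E)" by (simp add: E_def ac_simps)
  have "(norm (d - \<eta> *\<^sub>R D))\<^sup>2 = (norm d)\<^sup>2 - 2 * \<eta> * (d \<bullet> D) + \<eta>\<^sup>2 * (norm D)\<^sup>2"
    unfolding power2_norm_eq_inner
    by (simp add: inner_diff_left inner_diff_right inner_commute power2_eq_square algebra_simps)
  also have "\<dots> \<le> (1 - 2 * (\<eta> * \<alpha>)) * (norm d)\<^sup>2"
    using 1 2 by (simp add: algebra_simps)
  also have "\<dots> \<le> (1 - \<eta> * \<alpha>)\<^sup>2 * (norm d)\<^sup>2"
    by (intro mult_right_mono) (simp_all add: power2_diff)
  finally have "(norm (d - \<eta> *\<^sub>R D))\<^sup>2 \<le> ((1 - \<eta> * \<alpha>) * norm d)\<^sup>2"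
    by (simp add: power_mult_distrib)
  then have "norm (d - \<eta> *\<^sub>R D) \<le> (1 - \<eta> * \<alpha>) * norm d"
    using le1 by (intro power2_le_imp_le[of "norm (d - \<eta> *\<^sub>R D)"]) auto
  then show ?thesis by (simp add: d_def D_def \<alpha>_def algebra_simps)
qed

text \<open>Bounding \<open>\<mu> * (d \<bullet> D)\<close> by the first term of
  \<open>cocoercive\<close> leaves
  \<open>(norm D)\<^sup>2 \<le> \<beta> * (d \<bullet> D)\<close>.\<close>

lemma gradient_norm_le: "norm (G x - G y) \<le> \<beta> * norm (x - y)"
proof -
  define d where "d = x - y"
  define D where "D = G x - G y"
  have "\<mu> * (d \<bullet> D) \<le> \<mu> * (\<beta> * (norm d)\<^sup>2)"
    using upper_lipschitz[of x y] modulus_nonneg by (intro mult_left_mono) (auto simp: d_def D_def)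
  then have "(norm D)\<^sup>2 \<le> \<beta> * (d \<bullet> D)"
    using cocoercive[of x y] by (simp add: d_def D_def algebra_simps)
  also have "\<dots> \<le> \<beta> * (\<beta> * (norm d)\<^sup>2)"
    using upper_lipschitz[of x y] constant_pos by (intro mult_left_mono) (auto simp: d_def D_def)
  also have "\<dots> = (\<beta> * norm d)\<^sup>2" by (simp add: power2_eq_square)
  finally show ?thesis
    unfolding D_def[symmetric] d_def[symmetric]
    using constant_pos by (intro power2_le_imp_le[of "norm D"]) auto
qed

text \<open>For surjectivity, a solution of \<open>G x = u\<close> is a fixed point of the gradient
  step for \<open>q\<close> minus the linear form of \<open>u\<close>, and this step is a
  contraction.\<close>

lemma gradient_bij:
  assumes "0 < \<mu>"
  shows "bij G"
proof (rule bijI')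
  fix x y
  show "G x = G y \<longleftrightarrow> x = y"
    using strongly_monotone[of x y] assms by (auto simp: mult_le_0_iff)
next
  fix u
  define \<eta> where "\<eta> = 2 / (\<mu> + \<beta>)"
  have \<eta>: "0 < \<eta>" using assms constant_pos by (simp add: \<eta>_def)
  let ?c = "1 - \<eta> * (\<mu> * \<beta> / (\<mu> + \<beta>))"
  have contr: "norm ((x - \<eta> *\<^sub>R (G x - u)) - (y - \<eta> *\<^sub>R (G y - u))) \<le> ?c * norm (x - y)" for x y
    using gradient_step_contraction[of \<eta> x y] \<eta> by (simp add: \<eta>_def algebra_simps)
  \<comment> \<open>A unit vector in the contraction estimate shows that the factor is nonnegative,
    as the fixed point theorem requires.\<close>
  have "0 \<le> ?c * norm (b - 0)" if "b \<in> Basis" for b :: 'a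
    using contr[of b 0] norm_ge_zero order_trans by blast
  then have "0 \<le> ?c" using nonempty_Basis norm_Basis by (metis diff_zero ex_in_conv mult.right_neutral)
  moreover have "?c < 1" using \<eta> assms constant_pos by simp
  ultimately have "\<exists>!x. x - \<eta> *\<^sub>R (G x - u) = x"
    using contr by (intro banach_fix_type[of ?c]) (auto simp: dist_norm)
  then obtain x where "x - \<eta> *\<^sub>R (G x - u) = x" by blast
  then have "u = G x" using \<eta> by simp
  then show "\<exists>x. u = G x" ..
qed

text \<open>The Fenchel conjugate in Legendre form: for \<open>\<mu> > 0\<close> the supremum of
  \<open>u \<bullet> y - q y\<close> over \<open>y\<close> is attained at
  \<open>inv G u\<close>.\<close>

definition conjugate :: "'a \<Rightarrow> real"
  where "conjugate u = u \<bullet> inv G u - q (inv G u)"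

context
  assumes modulus_pos: "0 < \<mu>"
begin

lemma G_inv [simp]: "G (inv G u) = u"
  using gradient_bij[OF modulus_pos] by (simp add: bij_is_surj surj_f_inv_f)

lemma conjugate_strict_maximum: "u \<bullet> y - q y \<le> conjugate u - \<mu> / 2 * (norm (y - inv G u))\<^sup>2"
  using quadratic_lower_bound[of "inv G u" y]
  by (simp add: conjugate_def inner_diff_left inner_diff_right inner_commute)

lemma inverse_gradient_lipschitz: "norm (inv G u - inv G v) \<le> norm (u - v) / \<mu>"
proof -
  define d where "d = inv G u - inv G v"
  have "\<mu> * norm d * norm d \<le> d \<bullet> (u - v)"
    using strongly_monotone[of "inv G u" "inv G v"] by (simp add: d_def power2_eq_square)
  also have "\<dots> \<le> norm d * norm (u - v)" by (rule norm_cauchy_schwarz)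
  finally have "norm d * (\<mu> * norm d) \<le> norm d * norm (u - v)" by (simp add: ac_simps)
  then have "\<mu> * norm d \<le> norm (u - v)"
    by (cases "d = 0") (auto simp: mult_le_cancel_left)
  then show ?thesis using modulus_pos by (simp add: d_def field_simps)
qed

text \<open>Cocoercivity of \<open>G\<close> becomes strong monotonicity of \<open>inv G\<close>,
  and strong monotonicity of \<open>G\<close> becomes the upper bound, so the moduli are inverted
  and swap roles.\<close>

lemma conjugate_smooth_gradient: "smooth_gradient conjugate (inv G) (1 / \<beta>) (1 / \<mu>)"
proof
  fix u v
  define d where "d = inv G u - inv G v"
  have "\<mu> * (d \<bullet> (u - v)) \<le> \<mu> * (\<beta> * (norm d)\<^sup>2)"
    using upper_lipschitz[of "inv G u" "inv G v"] modulus_pos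
    by (intro mult_left_mono) (auto simp: d_def)
  then have "(norm (u - v))\<^sup>2 \<le> \<beta> * (d \<bullet> (u - v))"
    using cocoercive[of "inv G u" "inv G v"] by (simp add: d_def algebra_simps)
  then show "1 / \<beta> * (norm (u - v))\<^sup>2 \<le> (u - v) \<bullet> (inv G u - inv G v)"
    using constant_pos by (simp add: d_def field_simps inner_commute)
  have "(u - v) \<bullet> d \<le> norm (u - v) * norm d" by (rule norm_cauchy_schwarz)
  also have "\<dots> \<le> norm (u - v) * (norm (u - v) / \<mu>)"
    unfolding d_def by (intro mult_left_mono inverse_gradient_lipschitz) simp
  finally show "(u - v) \<bullet> (inv G u - inv G v) \<le> 1 / \<mu> * (norm (u - v))\<^sup>2"
    by (simp add: d_def power2_eq_square)
next
  fix u
  show "GDERIV conjugate u :> inv G u"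
  proof (rule gderiv_if_quadratic_error)
    fix v
    \<comment> \<open>Fenchel-Young makes \<open>inv G a\<close> a subgradient at \<open>a\<close>.
      Used at both ends, it puts the linearization error between 0 and
      \<open>(v - u) \<bullet> (inv G v - inv G u)\<close>.\<close>
    have sub: "(b - a) \<bullet> inv G a \<le> conjugate b - conjugate a" for a b
    proof -
      have "0 \<le> \<mu> / 2 * (norm (inv G a - inv G b))\<^sup>2" using modulus_pos by simp
      then show ?thesis
        using conjugate_strict_maximum[of b "inv G a"]
        by (simp add: conjugate_def[of a] inner_diff_left)
    qed
    have "(v - u) \<bullet> (inv G v - inv G u) \<le> norm (v - u) * norm (inv G v - inv G u)"
      by (rule norm_cauchy_schwarz)
    also have "\<dots> \<le> norm (v - u) * (norm (v - u) / \<mu>)"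
      by (intro mult_left_mono inverse_gradient_lipschitz) simp
    finally have "(v - u) \<bullet> (inv G v - inv G u) \<le> 1 / \<mu> * (norm (v - u))\<^sup>2"
      by (simp add: power2_eq_square)
    moreover have "(u - v) \<bullet> inv G v = - ((v - u) \<bullet> inv G v)"
      by (simp add: inner_diff_left)
    ultimately show "\<bar>conjugate v - conjugate u - (v - u) \<bullet> inv G u\<bar> \<le> 1 / \<mu> * (norm (v - u))\<^sup>2"
      using sub[where a = u and b = v] sub[where a = v and b = u] by (simp add: inner_diff_right)
  qed
next
  show "1 / \<beta> \<le> 1 / \<mu>" using modulus_le modulus_pos by (simp add: frac_le)
  show "0 \<le> 1 / \<beta>" "0 < 1 / \<mu>" using modulus_pos constant_pos by simp_all
qed

end

end

text \<open>The convexity inequality at parameter \<open>t\<close> is divided by \<open>t\<close>,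
  and \<open>t\<close> tends to 0 from the right.\<close>

lemma strongly_convex_gradient_inequality:
  assumes "strongly_convex \<mu> f" and "GDERIV f x :> D"
  shows "f x + (y - x) \<bullet> D + \<mu> / 2 * (norm (y - x))\<^sup>2 \<le> f y"
proof -
  let ?d = "y - x"
  have 1: "((\<lambda>t. x + t *\<^sub>R ?d) has_derivative (\<lambda>h. h *\<^sub>R ?d)) (at 0)"
    by (auto intro!: derivative_eq_intros)
  have 2: "(f has_derivative (\<lambda>h. h \<bullet> D)) (at (x + 0 *\<^sub>R ?d))"
    using assms(2) by (simp add: gderiv_def)
  have "((\<lambda>t. f (x + t *\<^sub>R ?d)) has_real_derivative ?d \<bullet> D) (at 0)"
    using has_derivative_compose[OF 1 2]
    by (simp add: has_field_derivative_def mult_commute_abs)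
  then have "((\<lambda>t. (f (x + t *\<^sub>R ?d) - f x) / t) \<longlongrightarrow> ?d \<bullet> D) (at 0)"
    by (simp add: DERIV_def)
  then have lim: "((\<lambda>t. (f (x + t *\<^sub>R ?d) - f x) / t) \<longlongrightarrow> ?d \<bullet> D) (at_right 0)"
    by (rule tendsto_within_subset) simp
  have rlim: "((\<lambda>t. f y - f x - \<mu> / 2 * (1 - t) * (norm ?d)\<^sup>2) \<longlongrightarrow>
      f y - f x - \<mu> / 2 * (1 - 0) * (norm ?d)\<^sup>2) (at_right 0)"
    by (intro tendsto_intros)
  have ev: "\<forall>\<^sub>F t in at_right 0. (f (x + t *\<^sub>R ?d) - f x) / t \<le> f y - f x - \<mu> / 2 * (1 - t) * (norm ?d)\<^sup>2"
    unfolding eventually_at_right_field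
  proof (intro exI conjI allI impI)
    fix t :: real assume t: "0 < t" "t < 1"
    have "(1 - t) *\<^sub>R x + t *\<^sub>R y = x + t *\<^sub>R ?d" by (simp add: algebra_simps)
    then have "f (x + t *\<^sub>R ?d) \<le> (1 - t) * f x + t * f y - \<mu> / 2 * t * (1 - t) * (norm ?d)\<^sup>2"
      using assms(1) t unfolding strongly_convex_def by (metis atLeastAtMost_iff less_imp_le norm_minus_commute)
    then have "f (x + t *\<^sub>R ?d) - f x \<le> t * (f y - f x - \<mu> / 2 * (1 - t) * (norm ?d)\<^sup>2)"
      by (simp add: algebra_simps)
    then show "(f (x + t *\<^sub>R ?d) - f x) / t \<le> f y - f x - \<mu> / 2 * (1 - t) * (norm ?d)\<^sup>2"
      using t by (simp add: divide_le_eq mult.commute)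
  qed simp
  have "?d \<bullet> D \<le> f y - f x - \<mu> / 2 * (1 - 0) * (norm ?d)\<^sup>2"
    by (rule tendsto_le[OF _ rlim lim ev]) simp
  then show ?thesis by simp
qed

text \<open>The first-order inequalities at \<open>x\<close> and at \<open>y\<close> add up to
  strong monotonicity, and Cauchy-Schwarz turns the Lipschitz condition into the upper
  bound.\<close>

lemma smooth_convex_class_smooth_gradient:
  assumes "f \<in> smooth_convex_class \<mu> \<beta>" and "0 \<le> \<mu>" and "\<mu> \<le> \<beta>" and "0 < \<beta>"
  shows "smooth_gradient f (grad f) \<mu> \<beta>"
proof
  show gd: "GDERIV f x :> grad f x" for x
    using assms by (intro gderiv_grad) (simp add: smooth_convex_class_def)
  fix x y
  have *: "f x + (y - x) \<bullet> grad f x + \<mu> / 2 * (norm (y - x))\<^sup>2 \<le> f y" for x y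
    using assms(1) gd by (intro strongly_convex_gradient_inequality) (simp add: smooth_convex_class_def)
  have "(x - y) \<bullet> (grad f x - grad f y) = - ((y - x) \<bullet> grad f x) - (x - y) \<bullet> grad f y"
    by (simp add: inner_diff_left inner_diff_right)
  then show "\<mu> * (norm (x - y))\<^sup>2 \<le> (x - y) \<bullet> (grad f x - grad f y)"
    using *[of x y] *[of y x] by (simp add: norm_minus_commute[of y x])
  have "(x - y) \<bullet> (grad f x - grad f y) \<le> norm (x - y) * norm (grad f x - grad f y)"
    by (rule norm_cauchy_schwarz)
  also have "\<dots> \<le> norm (x - y) * (\<beta> * norm (x - y))"
    using assms(1) lipschitz_onD[of \<beta> UNIV "grad f" x y]
    by (intro mult_left_mono) (auto simp: smooth_convex_class_def dist_norm)
  finally show "(x - y) \<bullet> (grad f x - grad f y) \<le> \<beta> * (norm (x - y))\<^sup>2"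
    by (simp add: power2_eq_square ac_simps)
qed (use assms in auto)

section \<open>Extremal singular values\<close>

text \<open>Otherwise a small step from \<open>v\<close> against \<open>B v\<close> would make the
  form negative.\<close>

lemma positive_semidefinite_kernel:
  fixes B :: "'a::real_inner \<Rightarrow> 'a"
  assumes lin: "linear B"
    and sym: "\<And>u v. u \<bullet> B v = B u \<bullet> v"
    and psd: "\<And>v. 0 \<le> v \<bullet> B v"
    and zero: "v \<bullet> B v = 0"
  shows "B v = 0"
proof (rule ccontr)
  assume "B v \<noteq> 0"
  define n where "n = B v \<bullet> B v"
  define c where "c = B v \<bullet> B (B v)"
  have n: "n > 0" using \<open>B v \<noteq> 0\<close> by (simp add: n_def)
  have c: "c \<ge> 0" using psd by (simp add: c_def)
  \<comment> \<open>Chosen so that \<open>t * c \<le> n\<close>; the summand 1 covers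
    \<open>c = 0\<close>.\<close>
  define t where "t = n / (c + 1)"
  have t: "t > 0" using n c by (simp add: t_def)
  have "0 \<le> (v - t *\<^sub>R B v) \<bullet> B (v - t *\<^sub>R B v)" by (rule psd)
  also have "\<dots> = t * (t * c - 2 * n)"
    using zero sym[of v "B v"]
    by (simp add: linear_diff[OF lin] linear_scale[OF lin] inner_diff_left inner_diff_right
        n_def c_def algebra_simps)
  finally have "2 * n \<le> t * c" using t by (simp add: zero_le_mult_iff)
  moreover have "t * c \<le> n" using n c by (simp add: t_def field_simps)
  ultimately show False using n by simp
qed

lemma inner_transpose_mult: "x \<bullet> (transpose A *v y) = (A *v x) \<bullet> (y :: real^'m)"
  for A :: "real^'n^'m"
  using dot_lmul_matrix[of y A x] by (simp add: inner_commute)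

lemma gram_mult: "(transpose A ** A) *v v = transpose A *v (A *v v)" for A :: "real^'n^'m"
  by (simp only: matrix_vector_mul_assoc)

lemma norm_mult_eigenvector:
  fixes A :: "real^'n^'m"
  assumes "(transpose A ** A) *v v = l *\<^sub>R v"
  shows "(norm (A *v v))\<^sup>2 = l * (norm v)\<^sup>2"
proof -
  have "v \<bullet> ((transpose A ** A) *v v) = (A *v v) \<bullet> (A *v v)"
    unfolding gram_mult inner_transpose_mult ..
  then show ?thesis by (simp add: assms power2_norm_eq_inner)
qed

text \<open>Eigenvectors of the Gram matrix for distinct eigenvalues are orthogonal.\<close>

lemma finite_singular_values: "finite (singular_values (A :: real^'n^'m))"
proof -
  define E where "E = {l. \<exists>v. v \<noteq> 0 \<and> (transpose A ** A) *v v = l *\<^sub>R v}"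
  define ev where "ev l = (SOME v. v \<noteq> 0 \<and> (transpose A ** A) *v v = l *\<^sub>R v)" for l
  have ev: "ev l \<noteq> 0" "(transpose A ** A) *v ev l = l *\<^sub>R ev l" if "l \<in> E" for l
    using someI_ex[of "\<lambda>v. v \<noteq> 0 \<and> (transpose A ** A) *v v = l *\<^sub>R v"] that
    by (auto simp: E_def ev_def)
  have orth: "ev k \<bullet> ev l = 0" if "k \<in> E" "l \<in> E" "k \<noteq> l" for k l
  proof -
    have "ev k \<bullet> ((transpose A ** A) *v ev l) = ev l \<bullet> ((transpose A ** A) *v ev k)"
      unfolding gram_mult inner_transpose_mult by (rule inner_commute)
    with that show ?thesis by (simp add: ev inner_commute)
  qed
  have "pairwise orthogonal (ev ` E)"
    using orth by (auto simp: pairwise_def orthogonal_def)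
  then have "finite (ev ` E)" by (rule pairwise_orthogonal_imp_finite)
  moreover have "inj_on ev E"
  proof (rule inj_onI, rule ccontr)
    fix k l assume "k \<in> E" "l \<in> E" "ev k = ev l" "k \<noteq> l"
    then show False using orth[of k l] ev(1)[of k] by simp
  qed
  ultimately have "finite E" by (simp add: finite_image_iff)
  moreover have "singular_values A = sqrt ` E" by (auto simp: singular_values_def E_def)
  ultimately show ?thesis by simp
qed

text \<open>At a maximizer (\<open>s = 1\<close>) or minimizer (\<open>s = -1\<close>) of the
  stretch, the form of the operator \<open>B\<close> below is positive semidefinite and vanishes at
  \<open>v\<close>. Hence \<open>v\<close> lies in the kernel of \<open>B\<close> and is an
  eigenvector of the Gram matrix.\<close>

lemma singular_value_if_extremal:
  fixes A :: "real^'n^'m"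
  assumes "\<bar>s\<bar> = 1" and "norm v = 1"
    and ext: "\<And>u. 0 \<le> s * ((norm (A *v v))\<^sup>2 * (norm u)\<^sup>2 - (norm (A *v u))\<^sup>2)"
  shows "norm (A *v v) \<in> singular_values A"
proof -
  let ?M = "(norm (A *v v))\<^sup>2"
  define B where "B u = s *\<^sub>R (?M *\<^sub>R u - transpose A *v (A *v u))" for u
  have form: "u \<bullet> B w = s * (?M * (u \<bullet> w) - (A *v u) \<bullet> (A *v w))" for u w
    unfolding B_def inner_scaleR_right inner_diff_right inner_transpose_mult ..
  have "B v = 0"
  proof (rule positive_semidefinite_kernel[of B v])
    show "linear B"
      unfolding B_def
      by (auto intro!: linearI simp: matrix_vector_right_distrib matrix_vector_mult_scaleR algebra_simps
          simp del: transpose_matrix_vector)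
    show "u \<bullet> B w = B u \<bullet> w" for u w
      using form[of u w] form[of w u] by (simp add: inner_commute)
    show "0 \<le> u \<bullet> B u" for u
      using ext[of u] by (simp add: form power2_norm_eq_inner)
    show "v \<bullet> B v = 0"
      using assms(2) by (simp add: form power2_norm_eq_inner[symmetric])
  qed
  then have "(transpose A ** A) *v v = ?M *\<^sub>R v"
    using assms(1) unfolding B_def gram_mult by auto
  moreover have "v \<noteq> 0" using assms(2) by auto
  moreover have "norm (A *v v) = sqrt ?M" by simp
  ultimately show ?thesis unfolding singular_values_def by blast
qed

section \<open>Largest and smallest stretch of a matrix\<close>

lemma norm_mult_rescale:
  fixes A :: "real^'n^'m"
  shows "norm (A *v u) = norm (A *v (u /\<^sub>R norm u)) * norm u"
  by (cases "u = 0") (simp_all add: matrix_vector_mult_scaleR)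

text \<open>Compactness of the unit sphere, followed by homogeneity.\<close>

lemma extremal_unit_vectors:
  fixes A :: "real^'n^'m"
  obtains v w where "norm v = 1" "\<And>u. norm (A *v u) \<le> norm (A *v v) * norm u"
    "norm w = 1" "\<And>u. norm (A *v w) * norm u \<le> norm (A *v u)"
proof -
  have sphere: "compact (sphere (0::real^'n) 1)" "sphere (0::real^'n) 1 \<noteq> {}"
    by simp_all
  have "continuous_on (sphere 0 1) (\<lambda>u. norm (A *v u))"
    by (intro continuous_on_norm linear_continuous_on matrix_vector_mul_bounded_linear)
  from continuous_attains_sup[OF sphere this] continuous_attains_inf[OF sphere this]
  obtain v w where v: "norm v = 1" "\<And>u. norm u = 1 \<Longrightarrow> norm (A *v u) \<le> norm (A *v v)"
    and w: "norm w = 1" "\<And>u. norm u = 1 \<Longrightarrow> norm (A *v w) \<le> norm (A *v u)"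
    by auto
  show thesis
  proof (rule that)
    show "norm (A *v u) \<le> norm (A *v v) * norm u" for u
      using v(2)[of "u /\<^sub>R norm u"]
      by (cases "u = 0") (auto simp: norm_mult_rescale[of A u] intro!: mult_right_mono)
    show "norm (A *v w) * norm u \<le> norm (A *v u)" for u
      using w(2)[of "u /\<^sub>R norm u"]
      by (cases "u = 0") (auto simp: norm_mult_rescale[of A u] intro!: mult_right_mono)
  qed (use v w in auto)
qed

text \<open>The largest stretch is itself a singular value.\<close>

lemma norm_mult_le_sigma_max: "norm (A *v u) \<le> sigma_max A * norm u" for A :: "real^'n^'m"
proof -
  obtain v where v: "norm v = 1" "\<And>u. norm (A *v u) \<le> norm (A *v v) * norm u"
    using extremal_unit_vectors[of A] by metis
  have "norm (A *v v) \<in> singular_values A"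
  proof (rule singular_value_if_extremal[of 1])
    fix u
    show "0 \<le> 1 * ((norm (A *v v))\<^sup>2 * (norm u)\<^sup>2 - (norm (A *v u))\<^sup>2)"
      using power_mono[OF v(2)[of u], of 2] by (simp add: power_mult_distrib)
  qed (use v in auto)
  then have "norm (A *v v) \<le> sigma_max A"
    unfolding sigma_max_def by (intro Max_ge finite_singular_values)
  then show ?thesis using v(2)[of u] by (meson mult_right_mono norm_ge_zero order_trans)
qed

text \<open>The smallest stretch is a singular value, so the set is nonempty and its
  \<open>Min\<close> is attained and lies below this stretch.\<close>

lemma sigma_min_attained:
  fixes A :: "real^'n^'m"
  shows "sigma_min A \<in> singular_values A" and "sigma_min A * norm u \<le> norm (A *v u)"
proof -
  obtain w where w: "norm w = 1" "\<And>u. norm (A *v w) * norm u \<le> norm (A *v u)"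
    using extremal_unit_vectors[of A] by metis
  have mem: "norm (A *v w) \<in> singular_values A"
  proof (rule singular_value_if_extremal[of "-1"])
    fix u
    show "0 \<le> -1 * ((norm (A *v w))\<^sup>2 * (norm u)\<^sup>2 - (norm (A *v u))\<^sup>2)"
      using power_mono[OF w(2)[of u], of 2] by (simp add: power_mult_distrib)
  qed (use w in auto)
  then show "sigma_min A \<in> singular_values A"
    unfolding sigma_min_def by (intro Min_in finite_singular_values) auto
  have "sigma_min A \<le> norm (A *v w)"
    unfolding sigma_min_def by (intro Min_le finite_singular_values mem)
  then show "sigma_min A * norm u \<le> norm (A *v u)"
    using w(2)[of u] by (meson mult_right_mono norm_ge_zero order_trans)
qed

lemma sigma_min_le_sigma_max: "sigma_min A \<le> sigma_max A" for A :: "real^'n^'m"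
  unfolding sigma_max_def by (intro Max_ge finite_singular_values sigma_min_attained)

text \<open>In HOL \<open>sqrt\<close> of a negative number is negative, so the eigenvalue has to be
  shown nonnegative.\<close>

lemma sigma_min_nonneg: "0 \<le> sigma_min A" for A :: "real^'n^'m"
proof -
  obtain l v where l: "sigma_min A = sqrt l" "v \<noteq> 0" "(transpose A ** A) *v v = l *\<^sub>R v"
    using sigma_min_attained(1)[of A] unfolding singular_values_def by blast
  have "0 \<le> l * (norm v)\<^sup>2"
    unfolding norm_mult_eigenvector[OF l(3), symmetric] by simp
  then show ?thesis using l(1,2) by (simp add: zero_le_mult_iff)
qed

text \<open>Full column rank makes \<open>A\<close> injective, so it does not annihilate the
  eigenvector.\<close>

lemma sigma_min_pos:
  fixes A :: "real^'n^'m"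
  assumes "rank A = CARD('n)"
  shows "0 < sigma_min A"
proof -
  obtain l v where l: "sigma_min A = sqrt l" "v \<noteq> 0" "(transpose A ** A) *v v = l *\<^sub>R v"
    using sigma_min_attained(1)[of A] unfolding singular_values_def by blast
  have "inj ((*v) A)" using assms by (simp add: full_rank_injective)
  then have "A *v v \<noteq> 0" using l(2) by (metis injD matrix_vector_mult_0_right)
  then have "0 < l * (norm v)\<^sup>2"
    unfolding norm_mult_eigenvector[OF l(3), symmetric] by simp
  then show ?thesis using l(1,2) by (simp add: zero_less_mult_iff)
qed

text \<open>The squared norm of \<open>?u\<close> is the inner product of \<open>A *v ?u\<close>
  with \<open>w\<close>, so the bound for \<open>A\<close> suffices.\<close>

lemma norm_transpose_mult_le_sigma_max: "norm (transpose A *v w) \<le> sigma_max A * norm w"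
  for A :: "real^'n^'m"
proof -
  let ?u = "transpose A *v w"
  have "norm ?u * norm ?u = (A *v ?u) \<bullet> w"
    using inner_transpose_mult[of ?u A w]
    by (simp add: power2_norm_eq_inner[symmetric] power2_eq_square del: transpose_matrix_vector)
  also have "\<dots> \<le> norm (A *v ?u) * norm w" by (rule norm_cauchy_schwarz)
  also have "\<dots> \<le> sigma_max A * norm ?u * norm w"
    by (intro mult_right_mono norm_mult_le_sigma_max norm_ge_zero)
  finally have *: "norm ?u * norm ?u \<le> norm ?u * (sigma_max A * norm w)"
    by (simp only: ac_simps)
  show ?thesis
  proof (cases "norm ?u = 0")
    case True
    have "0 \<le> sigma_max A"
      using sigma_min_nonneg[of A] sigma_min_le_sigma_max[of A] by linarith
    then show ?thesis using True by simp
  next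
    case False
    then show ?thesis using * by (metis mult_le_cancel_left_pos norm_ge_zero order_le_less)
  qed
qed

section \<open>Saddle points\<close>

text \<open>With the conjugate of \<open>g\<close> as \<open>c\<close>, this covers the primal
  function. Moving the transpose across the inner product reduces both bounds to those for
  \<open>F\<close> and \<open>H\<close>, with squared singular values as factors.\<close>

lemma smooth_gradient_add_comp:
  fixes A :: "real^'n^'m"
  assumes "smooth_gradient f F 0 b" and "smooth_gradient c H m M"
  shows "smooth_gradient (\<lambda>x. f x + c (A *v x)) (\<lambda>x. F x + transpose A *v H (A *v x))
    ((sigma_min A)\<^sup>2 * m) ((sigma_max A)\<^sup>2 * M + b)"
proof -
  interpret f: smooth_gradient f F 0 b by fact
  interpret c: smooth_gradient c H m M by fact
  have sq_le: "(sigma_min A)\<^sup>2 \<le> (sigma_max A)\<^sup>2"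
    by (intro power_mono sigma_min_le_sigma_max sigma_min_nonneg)
  show ?thesis
  proof
    fix x
    have 1: "((*v) A has_derivative (*v) A) (at x)"
      by (intro bounded_linear_imp_has_derivative matrix_vector_mul_bounded_linear)
    have 2: "(c has_derivative (\<lambda>h. h \<bullet> H (A *v x))) (at (A *v x))"
      using c.gderiv by (simp add: gderiv_def)
    have "GDERIV (\<lambda>x. c (A *v x)) x :> transpose A *v H (A *v x)"
      unfolding gderiv_def inner_transpose_mult by (rule has_derivative_compose[OF 1 2])
    with f.gderiv show "GDERIV (\<lambda>x. f x + c (A *v x)) x :> F x + transpose A *v H (A *v x)"
      by (rule GDERIV_add)
  next
    fix x y
    have split: "(x - y) \<bullet> (F x + transpose A *v H (A *v x) - (F y + transpose A *v H (A *v y)))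
        = (x - y) \<bullet> (F x - F y) + (A *v x - A *v y) \<bullet> (H (A *v x) - H (A *v y))"
      unfolding inner_diff_right inner_add_right inner_transpose_mult matrix_vector_mult_diff_distrib
      by simp
    have "(sigma_min A * norm (x - y))\<^sup>2 \<le> (norm (A *v (x - y)))\<^sup>2"
      by (intro power_mono sigma_min_attained mult_nonneg_nonneg sigma_min_nonneg) simp
    then have "m * ((sigma_min A)\<^sup>2 * (norm (x - y))\<^sup>2) \<le> m * (norm (A *v x - A *v y))\<^sup>2"
      using c.modulus_nonneg
      by (intro mult_left_mono) (simp_all add: power_mult_distrib matrix_vector_mult_diff_distrib)
    then show "(sigma_min A)\<^sup>2 * m * (norm (x - y))\<^sup>2
        \<le> (x - y) \<bullet> (F x + transpose A *v H (A *v x) - (F y + transpose A *v H (A *v y)))"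
      unfolding split
      using c.strongly_monotone[of "A *v x" "A *v y"] f.strongly_monotone[of x y]
      by (simp add: ac_simps)
    have "(norm (A *v (x - y)))\<^sup>2 \<le> (sigma_max A * norm (x - y))\<^sup>2"
      by (intro power_mono norm_mult_le_sigma_max) simp
    then have "M * (norm (A *v x - A *v y))\<^sup>2 \<le> M * ((sigma_max A)\<^sup>2 * (norm (x - y))\<^sup>2)"
      using c.constant_pos
      by (intro mult_left_mono) (simp_all add: power_mult_distrib matrix_vector_mult_diff_distrib)
    then show "(x - y) \<bullet> (F x + transpose A *v H (A *v x) - (F y + transpose A *v H (A *v y)))
        \<le> ((sigma_max A)\<^sup>2 * M + b) * (norm (x - y))\<^sup>2"
      unfolding split
      using c.upper_lipschitz[of "A *v x" "A *v y"] f.upper_lipschitz[of x y]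
      by (simp add: algebra_simps)
  next
    have "(sigma_min A)\<^sup>2 * m \<le> (sigma_max A)\<^sup>2 * M"
      by (intro mult_mono sq_le c.modulus_le c.modulus_nonneg) simp
    then show "(sigma_min A)\<^sup>2 * m \<le> (sigma_max A)\<^sup>2 * M + b"
      using f.constant_pos by simp
    show "0 \<le> (sigma_min A)\<^sup>2 * m" using c.modulus_nonneg by simp
    show "0 < (sigma_max A)\<^sup>2 * M + b"
      using c.constant_pos f.constant_pos by (simp add: add_nonneg_pos)
  qed
qed

text \<open>The supremum is attained at \<open>inv G (A *v x)\<close>. The extended real value is
  thus finite, and minimization takes place among real functions.\<close>

lemma primal_fun_conjugate:
  assumes "smooth_gradient g G \<mu> \<beta>" and "0 < \<mu>"
  shows "primal_fun f g A x = ereal (f x + smooth_gradient.conjugate g G (A *v x))"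
proof -
  interpret g: smooth_gradient g G \<mu> \<beta> by fact
  show ?thesis
    unfolding primal_fun_def
  proof (rule antisym)
    show "(SUP y. ereal (saddle_fun f g A x y)) \<le> ereal (f x + g.conjugate (A *v x))"
    proof (rule SUP_least)
      fix y
      have "0 \<le> \<mu> / 2 * (norm (y - inv G (A *v x)))\<^sup>2" using assms(2) by simp
      then show "ereal (saddle_fun f g A x y) \<le> ereal (f x + g.conjugate (A *v x))"
        using g.conjugate_strict_maximum[OF assms(2), of "A *v x" y]
        by (simp add: saddle_fun_def inner_commute)
    qed
    show "ereal (f x + g.conjugate (A *v x)) \<le> (SUP y. ereal (saddle_fun f g A x y))"
      by (rule SUP_upper2[of "inv G (A *v x)"])
        (simp_all add: saddle_fun_def g.conjugate_def inner_commute)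
  qed
qed

lemma primal_optimal_unique:
  fixes A :: "real^'n^'m"
  assumes g: "smooth_gradient g G \<mu> \<beta>" "0 < \<mu>"
    and p: "smooth_gradient (\<lambda>x. f x + smooth_gradient.conjugate g G (A *v x)) P \<mu>' \<beta>'" "0 < \<mu>'"
    and "P xs = 0"
  shows "{x. primal_optimal f g A x} = {xs}"
proof -
  interpret p: smooth_gradient "\<lambda>x. f x + smooth_gradient.conjugate g G (A *v x)" P \<mu>' \<beta>' by fact
  note opt = primal_optimal_def primal_fun_conjugate[OF g]
  have "primal_optimal f g A xs"
    unfolding opt
  proof
    fix x
    have "0 \<le> \<mu>' / 2 * (norm (x - xs))\<^sup>2" using p(2) by simp
    with p.minimizer_if_zero[OF assms(5), of x]
    show "ereal (f xs + smooth_gradient.conjugate g G (A *v xs))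
      \<le> ereal (f x + smooth_gradient.conjugate g G (A *v x))" by simp
  qed
  moreover have "x = xs" if "primal_optimal f g A x" for x
  proof -
    have "f x + smooth_gradient.conjugate g G (A *v x) \<le> f xs + smooth_gradient.conjugate g G (A *v xs)"
      using that unfolding opt by simp
    with p.minimizer_if_zero[OF assms(5), of x] have "\<mu>' / 2 * (norm (x - xs))\<^sup>2 \<le> 0" by linarith
    then show ?thesis using p(2) by (simp add: mult_le_0_iff)
  qed
  ultimately show ?thesis by blast
qed

text \<open>Stationarity makes the pair a saddle point. The dual function, even where it is minus
  infinity, lies below \<open>saddle_fun f g A xs\<close>, which has a strict maximum at
  \<open>ys\<close>.\<close>

lemma dual_optimal_unique:
  fixes A :: "real^'n^'m"
  assumes "smooth_gradient f F 0 b" and "smooth_gradient g G \<mu> \<beta>" and \<mu>: "0 < \<mu>"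
    and x_stationary: "F xs + transpose A *v ys = 0" and y_stationary: "G ys = A *v xs"
  shows "{y. dual_optimal f g A y} = {ys}"
proof -
  interpret f: smooth_gradient f F 0 b by fact
  interpret g: smooth_gradient g G \<mu> \<beta> by fact
  let ?L = "saddle_fun f g A"
  have x_min: "?L xs ys \<le> ?L x ys" for x
  proof -
    have "F xs = - (transpose A *v ys)" using x_stationary by (simp only: eq_neg_iff_add_eq_0)
    then have "(x - xs) \<bullet> F xs = - ((A *v x) \<bullet> ys - (A *v xs) \<bullet> ys)"
      by (simp only: inner_minus_right inner_transpose_mult inner_diff_left matrix_vector_mult_diff_distrib)
    then show ?thesis
      using f.quadratic_lower_bound[of xs x] by (simp add: saddle_fun_def inner_commute)
  qed
  have y_max: "?L xs y \<le> ?L xs ys - \<mu> / 2 * (norm (y - ys))\<^sup>2" for y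
    using g.quadratic_lower_bound[of ys y]
    by (simp add: saddle_fun_def y_stationary inner_diff_left)
  have dual_ys: "dual_fun f g A ys = ereal (?L xs ys)"
    unfolding dual_fun_def using x_min by (intro antisym INF_lower INF_greatest) auto
  have dual_le: "dual_fun f g A y \<le> ereal (?L xs ys - \<mu> / 2 * (norm (y - ys))\<^sup>2)" for y
    unfolding dual_fun_def using y_max by (intro INF_lower2[of xs]) auto
  have "dual_optimal f g A ys"
    unfolding dual_optimal_def dual_ys
  proof
    fix y
    have "0 \<le> \<mu> / 2 * (norm (y - ys))\<^sup>2" using \<mu> by simp
    then have "ereal (?L xs ys - \<mu> / 2 * (norm (y - ys))\<^sup>2) \<le> ereal (?L xs ys)" by simp
    with dual_le show "dual_fun f g A y \<le> ereal (?L xs ys)" by (rule order_trans)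
  qed
  moreover have "y = ys" if "dual_optimal f g A y" for y
  proof -
    have "ereal (?L xs ys) \<le> dual_fun f g A y"
      using that unfolding dual_optimal_def dual_ys[symmetric] by blast
    then have "ereal (?L xs ys) \<le> ereal (?L xs ys - \<mu> / 2 * (norm (y - ys))\<^sup>2)"
      using dual_le by (rule order_trans)
    then have "\<mu> / 2 * (norm (y - ys))\<^sup>2 \<le> 0" unfolding ereal_less_eq by linarith
    then show ?thesis using \<mu> by (simp add: mult_le_0_iff)
  qed
  ultimately show ?thesis by blast
qed

section \<open>Convergence\<close>

text \<open>
  With \<open>M\<close> the matrix of the recursion, \<open>b * c < a * d\<close> says \<open>det (I - M) > 0\<close>. It leaves room for a
  weight \<open>w\<close> with \<open>b / d < w < a / c\<close>, for which \<open>e + w r\<close> contracts.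
\<close>

lemma coupled_linear_recursion:
  fixes e r :: "nat \<Rightarrow> real"
  assumes e: "\<And>k. e (Suc k) \<le> (1 - a) * e k + b * r k"
    and r: "\<And>k. r (Suc k) \<le> c * e k + (1 - d) * r k"
    and nonneg: "\<And>k. 0 \<le> e k" "\<And>k. 0 \<le> r k"
    and pos: "0 < a" "0 < b" "0 < c" and det: "b * c < a * d"
  obtains C \<rho> where "0 \<le> C" "0 \<le> \<rho>" "\<rho> < 1" "\<And>k. e k \<le> C * \<rho> ^ k" "\<And>k. r k \<le> C * \<rho> ^ k"
proof -
  \<comment> \<open>The sign of \<open>d\<close> follows from the determinant condition.\<close>
  have "0 < a * d" using pos det by (meson less_trans mult_pos_pos)
  then have d: "0 < d" using pos by (simp add: zero_less_mult_iff)
  have "b / d < a / c" using det d pos by (simp add: field_simps)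
  then obtain w where w: "b / d < w" "w < a / c" using dense by blast
  have w0: "0 < w" using w(1) pos d by (meson divide_pos_pos less_trans)
  define V where "V k = e k + w * r k" for k
  \<comment> \<open>The contraction gaps of \<open>e k\<close> and of \<open>w * r k\<close> in the
    weighted sum \<open>V\<close>.\<close>
  have gap: "0 < a - w * c" "0 < d - b / w"
    using w w0 d pos by (simp_all add: field_simps)
  \<comment> \<open>The maximum with 0 keeps the rate nonnegative when both gaps exceed 1.\<close>
  define \<rho> where "\<rho> = max 0 (1 - min (a - w * c) (d - b / w))"
  have \<rho>: "0 \<le> \<rho>" "\<rho> < 1" "1 - (a - w * c) \<le> \<rho>" "1 - (d - b / w) \<le> \<rho>"
    using gap by (auto simp: \<rho>_def)
  have V0: "0 \<le> V k" for k using nonneg w0 by (simp add: V_def)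
  have step: "V (Suc k) \<le> \<rho> * V k" for k
  proof -
    have "V (Suc k) \<le> ((1 - a) * e k + b * r k) + w * (c * e k + (1 - d) * r k)"
      unfolding V_def using e r w0 by (intro add_mono mult_left_mono) auto
    also have "\<dots> = (1 - (a - w * c)) * e k + (1 - (d - b / w)) * (w * r k)"
      using w0 by (simp add: field_simps)
    also have "\<dots> \<le> \<rho> * e k + \<rho> * (w * r k)"
      using \<rho> nonneg w0 by (intro add_mono mult_right_mono) auto
    finally show ?thesis by (simp add: V_def algebra_simps)
  qed
  have V: "V k \<le> V 0 * \<rho> ^ k" for k
  proof (induction k)
    case (Suc k)
    have "V (Suc k) \<le> \<rho> * (V 0 * \<rho> ^ k)"
      using step[of k] mult_left_mono[OF Suc \<rho>(1)] by linarith
    then show ?case by (simp add: ac_simps)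
  qed simp
  define C where "C = V 0 * (1 + 1 / w)"
  have pw: "0 \<le> \<rho> ^ k" for k using \<rho>(1) by simp
  show thesis
  proof (rule that[of C \<rho>])
    show "0 \<le> C" using V0 w0 by (simp add: C_def)
    fix k
    have "e k \<le> V k" using nonneg w0 by (simp add: V_def)
    also have "\<dots> \<le> V 0 * \<rho> ^ k" by (rule V)
    also have "\<dots> \<le> C * \<rho> ^ k"
      unfolding C_def using V0[of 0] w0 pw by (intro mult_right_mono) (auto simp: algebra_simps)
    finally show "e k \<le> C * \<rho> ^ k" .
    have "w * r k \<le> V k" using nonneg by (simp add: V_def)
    then have "w * r k \<le> V 0 * \<rho> ^ k" using V[of k] by linarith
    then have "r k \<le> V 0 * (1 / w) * \<rho> ^ k" using w0 by (simp add: field_simps)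
    also have "\<dots> \<le> C * \<rho> ^ k"
      unfolding C_def using V0[of 0] w0 pw by (intro mult_right_mono) (auto simp: algebra_simps)
    finally show "r k \<le> C * \<rho> ^ k" .
  qed (use \<rho> in auto)
qed

theorem theorem8:
  fixes f :: "real^'n \<Rightarrow> real" and g :: "real^'m \<Rightarrow> real" and A :: "real^'n^'m"
    and x :: "nat \<Rightarrow> real^'n" and y :: "nat \<Rightarrow> real^'m"
    and \<beta>\<^sub>f \<mu>\<^sub>g \<beta>\<^sub>g \<mu>\<^sub>p \<beta>\<^sub>p \<beta>\<^sub>\<phi> \<alpha>\<^sub>p \<alpha>\<^sub>g \<eta>\<^sub>1 \<eta>\<^sub>2 :: real
  assumes "0 < \<beta>\<^sub>f" and "f \<in> smooth_convex_class 0 \<beta>\<^sub>f"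
    and "0 < \<mu>\<^sub>g" and "\<mu>\<^sub>g \<le> \<beta>\<^sub>g" and "g \<in> smooth_convex_class \<mu>\<^sub>g \<beta>\<^sub>g"
    and "rank A = CARD('n)"
    and "\<mu>\<^sub>p = (sigma_min A)\<^sup>2 / \<beta>\<^sub>g"
    and "\<beta>\<^sub>p = (sigma_max A)\<^sup>2 / \<mu>\<^sub>g + \<beta>\<^sub>f"
    and "\<beta>\<^sub>\<phi> = sigma_max A / \<mu>\<^sub>g"
    and "\<alpha>\<^sub>p = \<mu>\<^sub>p * \<beta>\<^sub>p / (\<mu>\<^sub>p + \<beta>\<^sub>p)"
    and "\<alpha>\<^sub>g = \<mu>\<^sub>g * \<beta>\<^sub>g / (\<mu>\<^sub>g + \<beta>\<^sub>g)"
    and "0 < \<eta>\<^sub>2" and "\<eta>\<^sub>2 \<le> 2 / (\<mu>\<^sub>g + \<beta>\<^sub>g)"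
    and "\<And>k. x (Suc k) = x k - \<eta>\<^sub>1 *\<^sub>R (grad f (x k) + transpose A *v y k)"
    and "\<And>k. y (Suc k) = y k + \<eta>\<^sub>2 *\<^sub>R (A *v x k - grad g (y k))"
    and "0 < \<eta>\<^sub>1"
    and "\<eta>\<^sub>1 < min (\<alpha>\<^sub>p * \<alpha>\<^sub>g * \<eta>\<^sub>2 / (sigma_max A * \<beta>\<^sub>\<phi> * (\<alpha>\<^sub>p + \<beta>\<^sub>p))) (2 / (\<mu>\<^sub>p + \<beta>\<^sub>p))"
  shows "\<exists>xs ys. {x'. primal_optimal f g A x'} = {xs} \<and> {y'. dual_optimal f g A y'} = {ys} \<and>
           converges_exponentially x xs \<and> converges_exponentially y ys"
proof -

  \<comment> \<open>Regularity of \<open>f\<close>, \<open>g\<close> and the primal function\<close>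
  have sf: "smooth_gradient f (grad f) 0 \<beta>\<^sub>f"
    using assms(1,2) by (intro smooth_convex_class_smooth_gradient) auto
  have sg: "smooth_gradient g (grad g) \<mu>\<^sub>g \<beta>\<^sub>g"
    using assms(3-5) by (intro smooth_convex_class_smooth_gradient) auto
  interpret g: smooth_gradient g "grad g" \<mu>\<^sub>g \<beta>\<^sub>g by (rule sg)
  define \<phi> where "\<phi> u = inv (grad g) (A *v u)" for u
  define P where "P u = grad f u + transpose A *v \<phi> u" for u
  \<comment> \<open>The conjugate of \<open>g\<close> has moduli \<open>1 / \<beta>\<^sub>g\<close>
    and \<open>1 / \<mu>\<^sub>g\<close>, which is where \<open>\<mu>\<^sub>p\<close> and
    \<open>\<beta>\<^sub>p\<close> come from.\<close>
  have sp: "smooth_gradient (\<lambda>x. f x + g.conjugate (A *v x)) P \<mu>\<^sub>p \<beta>\<^sub>p"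
    using smooth_gradient_add_comp[OF sf g.conjugate_smooth_gradient[OF assms(3)], of A]
    by (simp add: P_def[abs_def] \<phi>_def assms(7,8))
  interpret p: smooth_gradient "\<lambda>x. f x + g.conjugate (A *v x)" P \<mu>\<^sub>p \<beta>\<^sub>p by (rule sp)
  define \<sigma> where "\<sigma> = sigma_max A"
  have \<sigma>: "0 < \<sigma>"
    using sigma_min_pos[OF assms(6)] sigma_min_le_sigma_max[of A] by (simp add: \<sigma>_def)
  have \<beta>g: "0 < \<beta>\<^sub>g" by (rule g.constant_pos)
  have \<mu>p: "0 < \<mu>\<^sub>p" using sigma_min_pos[OF assms(6)] \<beta>g by (simp add: assms(7))
  have \<beta>p: "0 < \<beta>\<^sub>p" by (rule p.constant_pos)
  have \<beta>\<phi>: "0 < \<beta>\<^sub>\<phi>" using \<sigma> assms(3) by (simp add: assms(9) \<sigma>_def)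
  have \<alpha>p: "0 < \<alpha>\<^sub>p" using \<mu>p \<beta>p by (simp add: assms(10))

  \<comment> \<open>Primal and dual optimal solutions\<close>
  obtain xs where Pxs: "P xs = 0"
    using p.gradient_bij[OF \<mu>p] by (metis bij_pointE)
  define ys where "ys = \<phi> xs"
  have primal: "{x'. primal_optimal f g A x'} = {xs}"
    by (rule primal_optimal_unique[where f = f, OF sg assms(3) sp \<mu>p Pxs])
  have dual: "{y'. dual_optimal f g A y'} = {ys}"
  proof (rule dual_optimal_unique[OF sf sg assms(3)])
    show "grad f xs + transpose A *v ys = 0" using Pxs unfolding P_def ys_def .
    show "grad g ys = A *v xs" by (simp add: ys_def \<phi>_def g.G_inv[OF assms(3)])
  qed

  \<comment> \<open>Recursion for the two errors\<close>
  have \<phi>_lipschitz: "norm (\<phi> u - \<phi> v) \<le> \<beta>\<^sub>\<phi> * norm (u - v)" for u v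
  proof -
    have "norm (\<phi> u - \<phi> v) \<le> norm (A *v (u - v)) / \<mu>\<^sub>g"
      using g.inverse_gradient_lipschitz[OF assms(3), of "A *v u" "A *v v"]
      by (simp add: \<phi>_def matrix_vector_mult_diff_distrib)
    also have "\<dots> \<le> \<sigma> * norm (u - v) / \<mu>\<^sub>g"
      unfolding \<sigma>_def using assms(3) by (intro divide_right_mono norm_mult_le_sigma_max) simp
    finally show ?thesis by (simp add: assms(9) \<sigma>_def)
  qed

  define e where "e k = norm (x k - xs)" for k
  define r where "r k = norm (y k - \<phi> (x k))" for k
  \<comment> \<open>Adding and subtracting \<open>\<phi> (x k)\<close> exhibits the update as a
    gradient step on the primal function, perturbed by the tracking error.\<close>
  have step_eq: "x (Suc k) = x k - \<eta>\<^sub>1 *\<^sub>R P (x k) - \<eta>\<^sub>1 *\<^sub>R (transpose A *v (y k - \<phi> (x k)))" for k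
    unfolding assms(14) P_def matrix_vector_mult_diff_distrib by (simp add: algebra_simps)
  have coupling: "norm (transpose A *v (y k - \<phi> (x k))) \<le> \<sigma> * r k" for k
    unfolding \<sigma>_def r_def by (rule norm_transpose_mult_le_sigma_max)
  \<comment> \<open>\<open>xs\<close> is fixed by the exact step, which contracts since
    \<open>\<eta>\<^sub>1 < 2 / (\<mu>\<^sub>p + \<beta>\<^sub>p)\<close>.\<close>
  have e_step: "e (Suc k) \<le> (1 - \<eta>\<^sub>1 * \<alpha>\<^sub>p) * e k + \<eta>\<^sub>1 * \<sigma> * r k" for k
  proof -
    let ?u = "(x k - \<eta>\<^sub>1 *\<^sub>R P (x k)) - (xs - \<eta>\<^sub>1 *\<^sub>R P xs)"
    let ?w = "transpose A *v (y k - \<phi> (x k))"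
    have "x (Suc k) - xs = ?u - \<eta>\<^sub>1 *\<^sub>R ?w" unfolding step_eq Pxs by (simp add: algebra_simps)
    then have "e (Suc k) \<le> norm ?u + norm (\<eta>\<^sub>1 *\<^sub>R ?w)"
      unfolding e_def by (simp only: norm_triangle_ineq4)
    also have "norm ?u \<le> (1 - \<eta>\<^sub>1 * \<alpha>\<^sub>p) * e k"
      unfolding e_def assms(10) using assms(16,17) by (intro p.gradient_step_contraction) auto
    also have "norm (\<eta>\<^sub>1 *\<^sub>R ?w) \<le> \<eta>\<^sub>1 * (\<sigma> * r k)"
      using mult_left_mono[OF coupling, of \<eta>\<^sub>1 k] assms(16) by (simp only: norm_scaleR) simp
    finally show ?thesis by (simp add: ac_simps)
  qed
  \<comment> \<open>The target \<open>\<phi> (x k)\<close> of the dual step drifts with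
    \<open>x k\<close>; this bound controls the drift.\<close>
  have x_move: "norm (x (Suc k) - x k) \<le> \<eta>\<^sub>1 * (\<beta>\<^sub>p * e k + \<sigma> * r k)" for k
  proof -
    let ?w = "transpose A *v (y k - \<phi> (x k))"
    have "x (Suc k) - x k = - (\<eta>\<^sub>1 *\<^sub>R (P (x k) - P xs + ?w))"
      unfolding step_eq Pxs by (simp add: algebra_simps)
    then have "norm (x (Suc k) - x k) = \<eta>\<^sub>1 * norm (P (x k) - P xs + ?w)"
      using assms(16) by (simp only: norm_minus_cancel norm_scaleR abs_of_pos)
    also have "norm (P (x k) - P xs + ?w) \<le> \<beta>\<^sub>p * e k + \<sigma> * r k"
      unfolding e_def by (intro norm_triangle_mono p.gradient_norm_le coupling)
    finally show ?thesis using assms(16) by (simp add: mult_left_mono)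
  qed
  have r_step: "r (Suc k) \<le> \<eta>\<^sub>1 * \<beta>\<^sub>\<phi> * \<beta>\<^sub>p * e k + (1 - (\<eta>\<^sub>2 * \<alpha>\<^sub>g - \<eta>\<^sub>1 * \<beta>\<^sub>\<phi> * \<sigma>)) * r k" for k
  proof -
    \<comment> \<open>Since \<open>grad g (\<phi> (x k)) = A *v x k\<close>, the dual step at
      \<open>x k\<close> fixes \<open>\<phi> (x k)\<close>.\<close>
    have "y (Suc k) - \<phi> (x k) =
        (y k - \<eta>\<^sub>2 *\<^sub>R grad g (y k)) - (\<phi> (x k) - \<eta>\<^sub>2 *\<^sub>R grad g (\<phi> (x k)))"
      unfolding assms(15) by (simp add: \<phi>_def g.G_inv[OF assms(3)] algebra_simps)
    then have y_contr: "norm (y (Suc k) - \<phi> (x k)) \<le> (1 - \<eta>\<^sub>2 * \<alpha>\<^sub>g) * r k"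
      unfolding r_def assms(11) using assms(12,13) by (simp only:) (intro g.gradient_step_contraction; simp)
    have "norm (\<phi> (x (Suc k)) - \<phi> (x k)) \<le> \<beta>\<^sub>\<phi> * (\<eta>\<^sub>1 * (\<beta>\<^sub>p * e k + \<sigma> * r k))"
      using \<phi>_lipschitz[of "x (Suc k)" "x k"] mult_left_mono[OF x_move[of k], of \<beta>\<^sub>\<phi>] \<beta>\<phi> by linarith
    moreover have "r (Suc k) \<le> norm (y (Suc k) - \<phi> (x k)) + norm (\<phi> (x (Suc k)) - \<phi> (x k))"
      using norm_triangle_ineq4[of "y (Suc k) - \<phi> (x k)" "\<phi> (x (Suc k)) - \<phi> (x k)"]
      by (simp add: r_def)
    ultimately show ?thesis using y_contr by (simp add: algebra_simps)
  qed
  \<comment> \<open>Multiplied out, the terms quadratic in \<open>\<eta>\<^sub>1\<close> collect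
    into the factor \<open>\<alpha>\<^sub>p + \<beta>\<^sub>p\<close> of the step size
    bound.\<close>
  have det: "(\<eta>\<^sub>1 * \<sigma>) * (\<eta>\<^sub>1 * \<beta>\<^sub>\<phi> * \<beta>\<^sub>p) < (\<eta>\<^sub>1 * \<alpha>\<^sub>p) * (\<eta>\<^sub>2 * \<alpha>\<^sub>g - \<eta>\<^sub>1 * \<beta>\<^sub>\<phi> * \<sigma>)"
  proof -
    have "0 < \<sigma> * \<beta>\<^sub>\<phi> * (\<alpha>\<^sub>p + \<beta>\<^sub>p)" using \<sigma> \<beta>\<phi> \<alpha>p \<beta>p by simp
    then have "\<eta>\<^sub>1 * (\<sigma> * \<beta>\<^sub>\<phi> * (\<alpha>\<^sub>p + \<beta>\<^sub>p)) < \<alpha>\<^sub>p * \<alpha>\<^sub>g * \<eta>\<^sub>2"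
      using assms(17) by (simp add: \<sigma>_def pos_less_divide_eq)
    then have "\<eta>\<^sub>1 * (\<eta>\<^sub>1 * (\<sigma> * \<beta>\<^sub>\<phi> * (\<alpha>\<^sub>p + \<beta>\<^sub>p))) < \<eta>\<^sub>1 * (\<alpha>\<^sub>p * \<alpha>\<^sub>g * \<eta>\<^sub>2)"
      using assms(16) by (rule mult_strict_left_mono)
    then show ?thesis by (simp add: algebra_simps)
  qed

  \<comment> \<open>Exponential rates\<close>
  obtain C \<rho> where C: "0 \<le> C" "0 \<le> \<rho>" "\<rho> < 1"
    and e_le: "\<And>k. e k \<le> C * \<rho> ^ k" and r_le: "\<And>k. r k \<le> C * \<rho> ^ k"
  proof (rule coupled_linear_recursion[of e "\<eta>\<^sub>1 * \<alpha>\<^sub>p" "\<eta>\<^sub>1 * \<sigma>" r, OF e_step r_step])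
    show "0 < \<eta>\<^sub>1 * \<alpha>\<^sub>p" "0 < \<eta>\<^sub>1 * \<sigma>" "0 < \<eta>\<^sub>1 * \<beta>\<^sub>\<phi> * \<beta>\<^sub>p"
      using assms(16) \<alpha>p \<sigma> \<beta>\<phi> \<beta>p by simp_all
  qed (use det in \<open>simp_all add: e_def r_def\<close>)

  have "converges_exponentially x xs"
    unfolding converges_exponentially_def using C e_le unfolding e_def by blast
  moreover have "converges_exponentially y ys"
    unfolding converges_exponentially_def
  proof (intro exI conjI allI)
    show "0 \<le> C * (1 + \<beta>\<^sub>\<phi>)" using C \<beta>\<phi> by simp
    fix k
    \<comment> \<open>The distance is split at \<open>\<phi> (x k)\<close>; Lipschitz continuity of
      \<open>\<phi>\<close> accounts for the factor \<open>1 + \<beta>\<^sub>\<phi>\<close>.\<close>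
    have "norm (y k - ys) \<le> r k + norm (\<phi> (x k) - \<phi> xs)"
      unfolding r_def ys_def using norm_triangle_ineq[of "y k - \<phi> (x k)" "\<phi> (x k) - \<phi> xs"] by simp
    also have "\<dots> \<le> C * \<rho> ^ k + \<beta>\<^sub>\<phi> * (C * \<rho> ^ k)"
      using r_le[of k] \<phi>_lipschitz[of "x k" xs] mult_left_mono[OF e_le[of k], of \<beta>\<^sub>\<phi>] \<beta>\<phi>
      unfolding e_def by linarith
    finally show "norm (y k - ys) \<le> C * (1 + \<beta>\<^sub>\<phi>) * \<rho> ^ k" by (simp add: algebra_simps)
  qed (use C in auto)
  ultimately show ?thesis using primal dual by blast
qed

end
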